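(* Let $L/K$ be an unramified quadratic extension with $\Delta=\sqrt{\epsilon}$ as in the context, $n\ge2$ and $1\le d<n$. Then $\{[u_\alpha\mathcal{O}_n]:\alpha\in I_d(n)\}$ is exactly the set of vertices $x$ of the Bruhat–Tits tree with $d(x,[\mathcal{O}_{n-d}])=d$ whose geodesic to $[\mathcal{O}_{n-d}]$ does not pass through $[\mathcal{O}_{n-d-1}]$.
   Context: $K$ is a nonarchimedean local field of characteristic zero with ring of integers $\mathcal{O}_K$, uniformizer $p$. $L=K(\sqrt{\epsilon})$ is the unramified quadratic extension, $\epsilon$ a nonsquare unit of $\mathcal{O}_K$, so $\mathcal{O}_L=\mathcal{O}_K[\sqrt\epsilon]$; $\mathcal{O}_m=\mathcal{O}_K[p^m\sqrt\epsilon]$ for $m\ge0$. $R(p)\subset\mathcal{O}_K$ is a set of representatives of $\mathcal{O}_K/p\mathcal{O}_K$; $u^{(i)}_t=1+tp^i\sqrt\epsilon$ for $i\ge1$, $t\in R(p)$. $I_d(n)$ is the set of tuples $\alpha=(\alpha_{n-d},\dots,\alpha_{n-1})\in R(p)^d$ and $u_\alpha=u^{(n-d)}_{\alpha_{n-d}}\cdots u^{(n-1)}_{\alpha_{n-1}}$. The Bruhat–Tits tree of $SL(2,K)$ has vertices the $K^*$-homothety classes $[\Lambda]$ of $\mathcal{O}_K$-lattices in $L$, adjacent iff representatives satisfy $p\Lambda\subsetneq\Lambda'\subsetneq\Lambda$. *)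

theory Defs
  imports
    "HOL-Library.FuncSet"
    "HOL-Computational_Algebra.Polynomial"
    "Graph_Theory.Digraph"
    "Graph_Theory.Arc_Walk"
    "Graph_Theory.Shortest_Path"
begin

text \<open>
  The big field \<open>L\<close> is the type \<^typ>\<open>'a\<close>; subfields and subrings of it are sets.
\<close>

definition is_subfield :: "'a::field set \<Rightarrow> bool" where
  "is_subfield F \<longleftrightarrow> 0 \<in> F \<and> 1 \<in> F \<and>
     (\<forall>x\<in>F. \<forall>y\<in>F. x - y \<in> F \<and> x * y \<in> F) \<and> (\<forall>x\<in>F. inverse x \<in> F)"

definition field_adjoin :: "'a::field set \<Rightarrow> 'a \<Rightarrow> 'a set" where
  "field_adjoin F x = \<Inter>{E. is_subfield E \<and> F \<subseteq> E \<and> x \<in> E}"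

definition ring_adjoin :: "'a::field set \<Rightarrow> 'a \<Rightarrow> 'a set" where
  "ring_adjoin A x = {poly f x | f. \<forall>i. coeff f i \<in> A}"

definition integral_closure :: "'a::field set \<Rightarrow> 'a set" where
  "integral_closure A = {x. \<exists>f. lead_coeff f = 1 \<and> (\<forall>i. coeff f i \<in> A) \<and> poly f x = 0}"

text \<open>
  The value of a valuation at \<open>0\<close> is never used; \<open>0\<close> is treated as having infinite valuation.
\<close>

definition val_ring :: "'a::field set \<Rightarrow> ('a \<Rightarrow> int) \<Rightarrow> 'a set" where
  "val_ring K v = {x \<in> K. x = 0 \<or> 0 \<le> v x}"

definition val_ideal :: "'a::field set \<Rightarrow> ('a \<Rightarrow> int) \<Rightarrow> 'a set" where
  "val_ideal K v = {x \<in> K. x = 0 \<or> 0 < v x}"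

definition residue_field :: "'a::field set \<Rightarrow> ('a \<Rightarrow> int) \<Rightarrow> 'a set set" where
  "residue_field K v = val_ring K v //
     {(x, y). x \<in> val_ring K v \<and> y \<in> val_ring K v \<and> x - y \<in> val_ideal K v}"

text \<open>
  A nonarchimedean local field: complete with respect to a normalised discrete valuation, with
  finite residue field. Characteristic zero comes from the type class.
\<close>

locale nonarch_local_field =
  fixes K :: "'a::field_char_0 set" and v :: "'a \<Rightarrow> int"
  assumes subfield: "is_subfield K"
    and val_mult: "\<And>x y. x \<in> K \<Longrightarrow> y \<in> K \<Longrightarrow> x \<noteq> 0 \<Longrightarrow> y \<noteq> 0 \<Longrightarrow> v (x * y) = v x + v y"
    and val_add: "\<And>x y. x \<in> K \<Longrightarrow> y \<in> K \<Longrightarrow> x \<noteq> 0 \<Longrightarrow> y \<noteq> 0 \<Longrightarrow> x + y \<noteq> 0 \<Longrightarrow>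
                    min (v x) (v y) \<le> v (x + y)"
    and val_normalised: "\<exists>x\<in>K. x \<noteq> 0 \<and> v x = 1"
    and complete: "\<And>s :: nat \<Rightarrow> 'a. (\<And>i. s i \<in> K) \<Longrightarrow>
          (\<And>N. \<exists>M. \<forall>i\<ge>M. \<forall>j\<ge>M. s i = s j \<or> N \<le> v (s i - s j)) \<Longrightarrow>
          \<exists>l\<in>K. \<forall>N. \<exists>M. \<forall>i\<ge>M. s i = l \<or> N \<le> v (s i - l)"
    and finite_residue_field: "finite (residue_field K v)"

definition uniformizer :: "'a::field set \<Rightarrow> ('a \<Rightarrow> int) \<Rightarrow> 'a \<Rightarrow> bool" where
  "uniformizer K v p \<longleftrightarrow> p \<in> K \<and> p \<noteq> 0 \<and> v p = 1"

definition val_unit :: "'a::field set \<Rightarrow> ('a \<Rightarrow> int) \<Rightarrow> 'a \<Rightarrow> bool" where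
  "val_unit K v x \<longleftrightarrow> x \<in> val_ring K v \<and> (\<exists>y\<in>val_ring K v. x * y = 1)"

text \<open>
  The whole field is unramified over \<open>K\<close>: the uniformizer \<open>p\<close> of \<open>K\<close> generates the maximal ideal
  (the set of nonunits) of the ring of integers upstairs. Separability of the residue extension is
  automatic, the residue fields being finite.
\<close>

definition unramified :: "'a::field set \<Rightarrow> ('a \<Rightarrow> int) \<Rightarrow> 'a \<Rightarrow> bool" where
  "unramified K v p \<longleftrightarrow>
     (let OL = integral_closure (val_ring K v)
      in {x \<in> OL. \<not> (\<exists>y\<in>OL. x * y = 1)} = (*) p ` OL)"

definition residue_reps :: "'a::field set \<Rightarrow> ('a \<Rightarrow> int) \<Rightarrow> 'a \<Rightarrow> 'a set \<Rightarrow> bool" where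
  "residue_reps K v p R \<longleftrightarrow> R \<subseteq> val_ring K v \<and>
     (\<forall>x\<in>val_ring K v. \<exists>!r. r \<in> R \<and> x - r \<in> (*) p ` val_ring K v)"

definition lin_span :: "'a::field set \<Rightarrow> 'a set \<Rightarrow> 'a set" where
  "lin_span A S = {\<Sum>s\<in>S. c s * s | c. \<forall>s\<in>S. c s \<in> A}"

text \<open>
  Lattices are the finitely generated \<open>O\<^sub>K\<close>-submodules that span \<open>L\<close> over \<open>K\<close>.
\<close>

definition is_lattice :: "'a::field set \<Rightarrow> ('a \<Rightarrow> int) \<Rightarrow> 'a set \<Rightarrow> bool" where
  "is_lattice K v \<Lambda> \<longleftrightarrow>
     (\<exists>S. finite S \<and> \<Lambda> = lin_span (val_ring K v) S \<and> lin_span K S = UNIV)"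

definition homothety_class :: "'a::field set \<Rightarrow> 'a set \<Rightarrow> 'a set set" where
  "homothety_class K \<Lambda> = {(*) c ` \<Lambda> | c. c \<in> K \<and> c \<noteq> 0}"

definition bt_vertices :: "'a::field set \<Rightarrow> ('a \<Rightarrow> int) \<Rightarrow> 'a set set set" where
  "bt_vertices K v = {homothety_class K \<Lambda> | \<Lambda>. is_lattice K v \<Lambda>}"

definition bt_tree ::
  "'a::field set \<Rightarrow> ('a \<Rightarrow> int) \<Rightarrow> 'a \<Rightarrow> ('a set set, 'a set set \<times> 'a set set) pre_digraph" where
  "bt_tree K v p = \<lparr>
     verts = bt_vertices K v,
     arcs = {(x, y). x \<in> bt_vertices K v \<and> y \<in> bt_vertices K v \<and>
                     (\<exists>\<Lambda>\<in>x. \<exists>\<Lambda>'\<in>y. (*) p ` \<Lambda> \<subset> \<Lambda>' \<and> \<Lambda>' \<subset> \<Lambda>)},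
     tail = fst, head = snd \<rparr>"

lemma wf_digraph_bt_tree: "wf_digraph (bt_tree K v p)"
  by unfold_locales (auto simp: bt_tree_def)

definition graph_dist :: "('v, 'e) pre_digraph \<Rightarrow> 'v \<Rightarrow> 'v \<Rightarrow> ereal" where
  "graph_dist G x y = wf_digraph.\<mu> G (\<lambda>_. 1) x y"

definition is_geodesic :: "('v, 'e) pre_digraph \<Rightarrow> 'v \<Rightarrow> 'e list \<Rightarrow> 'v \<Rightarrow> bool" where
  "is_geodesic G x es y \<longleftrightarrow>
     pre_digraph.awalk G x es y \<and> ereal (real (length es)) = graph_dist G x y"

definition quad_order :: "'a::field set \<Rightarrow> ('a \<Rightarrow> int) \<Rightarrow> 'a \<Rightarrow> 'a \<Rightarrow> nat \<Rightarrow> 'a set" where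
  "quad_order K v p \<Delta> m = ring_adjoin (val_ring K v) (p ^ m * \<Delta>)"

definition index_tuples :: "'a set \<Rightarrow> nat \<Rightarrow> nat \<Rightarrow> (nat \<Rightarrow> 'a) set" where
  "index_tuples R d n = {n - d..<n} \<rightarrow>\<^sub>E R"

definition u_gen :: "'a::field \<Rightarrow> 'a \<Rightarrow> nat \<Rightarrow> 'a \<Rightarrow> 'a" where
  "u_gen p \<Delta> i t = 1 + t * p ^ i * \<Delta>"

definition u_tuple :: "'a::field \<Rightarrow> 'a \<Rightarrow> nat \<Rightarrow> nat \<Rightarrow> (nat \<Rightarrow> 'a) \<Rightarrow> 'a" where
  "u_tuple p \<Delta> d n \<alpha> = (\<Prod>i\<in>{n - d..<n}. u_gen p \<Delta> i (\<alpha> i))"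

end

theory Submission
  imports Defs
begin

text \<open>
  Every lattice is homothetic to one with basis \<open>1 + c\<Delta>, p\<^sup>k\<Delta>\<close>, where \<open>k\<close> is unique and \<open>c\<close> is
  unique modulo \<open>p\<^sup>k\<close>; lowering \<open>k\<close> by one is a step of the tree. Hence the distance of this vertex
  from \<open>[O\<^sub>m]\<close>, which has \<open>c = 0\<close> and \<open>k = m\<close>, is \<open>k + m - 2j\<close> with \<open>j = min(k, m, v(c))\<close>, and a geodesic
  runs through \<open>[O\<^sub>m\<^sub>-\<^sub>1]\<close> unless \<open>j = m\<close>. So both sides of the claim are the set of vertices with
  \<open>k = n\<close> and \<open>c\<close> divisible by \<open>p\<^sup>n\<^sup>-\<^sup>d\<close>: the lattice \<open>(a + b\<Delta>) O\<^sub>n\<close>, for \<open>a\<close> congruent to 1 and \<open>b\<close> to 0 modulo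
  \<open>p\<close>, has \<open>k = n\<close> and \<open>c = b / a\<close>, and the slopes \<open>b / a\<close> of the \<open>u\<^sub>\<alpha>\<close> are computed by successive
  approximation.
\<close>

text \<open>The distance is an infimum of walk costs. With unit weights the cost is the length, so a
  walk of minimal length attains it.\<close>

lemma (in wf_digraph) graph_dist_eqI:
  assumes "awalk x es y" "\<And>es'. awalk x es' y \<Longrightarrow> length es \<le> length es'"
  shows "graph_dist G x y = ereal (real (length es))"
proof -
  have cost: "awalk_cost (\<lambda>_. 1) es' = real (length es')" for es'
    by (induction es') auto
  show ?thesis unfolding graph_dist_def \<mu>_def cost
    using assms by (intro INF_eqI) (auto intro: antisym)
qed

section \<open>Valuation and fractional ideals of \<open>K\<close>\<close>

context nonarch_local_field
begin

lemma zero_K [simp]: "0 \<in> K" and one_K [simp]: "1 \<in> K"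
  and diff_K [simp]: "x \<in> K \<Longrightarrow> y \<in> K \<Longrightarrow> x - y \<in> K"
  and mult_K [simp]: "x \<in> K \<Longrightarrow> y \<in> K \<Longrightarrow> x * y \<in> K"
  and inverse_K [simp]: "x \<in> K \<Longrightarrow> inverse x \<in> K"
  using subfield by (auto simp: is_subfield_def)

lemma uminus_K [simp]: "x \<in> K \<Longrightarrow> - x \<in> K"
  using diff_K[of 0 x] by simp

lemma add_K [simp]: "x \<in> K \<Longrightarrow> y \<in> K \<Longrightarrow> x + y \<in> K"
  using diff_K[of x "- y"] by simp

lemma divide_K [simp]: "x \<in> K \<Longrightarrow> y \<in> K \<Longrightarrow> x / y \<in> K"
  by (simp add: field_class.field_divide_inverse)

lemma power_K [simp]: "x \<in> K \<Longrightarrow> x ^ n \<in> K"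
  by (induction n) auto

lemma power_int_K [simp]: "x \<in> K \<Longrightarrow> x powi k \<in> K"
  by (simp add: power_int_def)

lemma sum_K: "(\<And>s. s \<in> S \<Longrightarrow> f s \<in> K) \<Longrightarrow> sum f S \<in> K"
  by (induction S rule: infinite_finite_induct) auto

lemma val_one [simp]: "v 1 = 0"
  using val_mult[of 1 1] by simp

lemma val_uminus [simp]:
  assumes "x \<in> K" "x \<noteq> 0"
  shows "v (- x) = v x"
proof -
  have "v (- 1) = 0" using val_mult[of "- 1" "- 1"] by simp
  then show ?thesis using val_mult[of "- 1" x] assms by simp
qed

lemma val_inverse:
  assumes "x \<in> K" "x \<noteq> 0"
  shows "v (inverse x) = - v x"
  using val_mult[of x "inverse x"] assms by simp

lemma val_divide:
  assumes "x \<in> K" "x \<noteq> 0" "y \<in> K" "y \<noteq> 0"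
  shows "v (x / y) = v x - v y"
  using val_mult[of x "inverse y"] val_inverse[of y] assms
  by (simp add: field_class.field_divide_inverse)

lemma val_power:
  assumes "x \<in> K" "x \<noteq> 0"
  shows "v (x ^ n) = int n * v x"
proof (induction n)
  case (Suc n)
  then show ?case using val_mult[of x "x ^ n"] assms by (simp add: algebra_simps)
qed simp

text \<open>The powers of the maximal ideal, negative exponents included. Congruences and
  divisibility become membership statements in which 0 counts as having infinite valuation.\<close>

definition frac_ideal :: "int \<Rightarrow> 'a set" (\<open>\<pp>\<close>) where
  "\<pp> k = {x \<in> K. x = 0 \<or> k \<le> v x}"

lemma val_ring_eq: "val_ring K v = \<pp> 0"
  by (simp add: val_ring_def frac_ideal_def)

lemma frac_ideal_K: "x \<in> \<pp> k \<Longrightarrow> x \<in> K"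
  and zero_frac_ideal [simp]: "0 \<in> \<pp> k"
  by (simp_all add: frac_ideal_def)

lemma frac_ideal_mono: "x \<in> \<pp> k \<Longrightarrow> j \<le> k \<Longrightarrow> x \<in> \<pp> j"
  by (auto simp: frac_ideal_def)

lemma frac_ideal_uminus [simp]: "x \<in> \<pp> k \<Longrightarrow> - x \<in> \<pp> k"
  by (cases "x = 0") (auto simp: frac_ideal_def)

lemma frac_ideal_add: "x \<in> \<pp> k \<Longrightarrow> y \<in> \<pp> k \<Longrightarrow> x + y \<in> \<pp> k"
  using val_add[of x y] by (cases "x = 0 \<or> y = 0 \<or> x + y = 0") (auto simp: frac_ideal_def)

lemma frac_ideal_diff: "x \<in> \<pp> k \<Longrightarrow> y \<in> \<pp> k \<Longrightarrow> x - y \<in> \<pp> k"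
  using frac_ideal_add[of x k "- y"] by simp

lemma frac_ideal_sum: "(\<And>s. s \<in> S \<Longrightarrow> f s \<in> \<pp> k) \<Longrightarrow> sum f S \<in> \<pp> k"
  by (induction S rule: infinite_finite_induct) (auto intro: frac_ideal_add)

lemma frac_ideal_mult: "x \<in> \<pp> j \<Longrightarrow> y \<in> \<pp> k \<Longrightarrow> i \<le> j + k \<Longrightarrow> x * y \<in> \<pp> i"
  using val_mult[of x y] by (cases "x = 0 \<or> y = 0") (auto simp: frac_ideal_def)

lemma mem_frac_ideal_val: "x \<in> K \<Longrightarrow> x \<in> \<pp> (v x)"
  by (simp add: frac_ideal_def)

lemma frac_ideal_divide:
  assumes "x \<in> \<pp> (k + v y)" "y \<in> K" "y \<noteq> 0"
  shows "x / y \<in> \<pp> k"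
  using assms val_divide[of x y] by (cases "x = 0") (auto simp: frac_ideal_def)

lemma mult_mem_frac_ideal_iff:
  assumes "s \<in> K" "s \<noteq> 0" "x \<in> K"
  shows "s * x \<in> \<pp> k \<longleftrightarrow> x \<in> \<pp> (k - v s)"
  using assms val_mult[of s x] by (cases "x = 0") (auto simp: frac_ideal_def)

text \<open>If \<open>a\<close> lay in \<open>\<pp> 1\<close>, so would
  \<open>1 = a - (a - 1)\<close>, although \<open>v 1 = 0\<close>.\<close>

lemma unit_of_mem_one_plus:
  assumes "a - 1 \<in> \<pp> 1"
  shows "a \<in> K" "a \<noteq> 0" "v a = 0" "a \<in> \<pp> 0"
proof -
  show K: "a \<in> K" using add_K[OF frac_ideal_K[OF assms], of 1] by simp
  show ne: "a \<noteq> 0"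
  proof
    assume "a = 0"
    then show False using assms by (simp add: frac_ideal_def)
  qed
  have a: "a \<in> \<pp> 0"
    using frac_ideal_add[of "a - 1" 0 1] assms frac_ideal_mono[of "a - 1" 1 0]
    by (simp add: frac_ideal_def)
  then show "a \<in> \<pp> 0" .
  have "\<not> 1 \<le> v a"
  proof
    assume "1 \<le> v a"
    then have "a \<in> \<pp> 1" using K by (simp add: frac_ideal_def)
    then have "1 \<in> \<pp> 1" using frac_ideal_diff[OF _ assms, of a] by simp
    then show False by (simp add: frac_ideal_def)
  qed
  then show "v a = 0" using a ne by (auto simp: frac_ideal_def)
qed

end

section \<open>Coordinates in the quadratic extension\<close>

locale quadratic_lattices = nonarch_local_field +
  fixes p \<Delta> :: 'a
  assumes unif: "uniformizer K v p"
    and Delta_not_K: "\<Delta> \<notin> K"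
    and Delta_square: "\<Delta> ^ 2 \<in> val_ring K v"
    and adjoin: "field_adjoin K \<Delta> = UNIV"
begin

lemma p_K [simp]: "p \<in> K" and p_nz [simp]: "p \<noteq> 0" and val_p [simp]: "v p = 1"
  using unif by (auto simp: uniformizer_def)

lemma val_p_powi [simp]: "v (p powi k) = k"
  by (simp add: power_int_def val_power val_inverse)

lemma p_powi_nz [simp]: "p powi k \<noteq> 0"
  by simp

lemma p_powi_mem_iff: "p powi k \<in> \<pp> j \<longleftrightarrow> j \<le> k"
  by (simp add: frac_ideal_def)

lemma p_power_mem_iff: "p ^ n \<in> \<pp> j \<longleftrightarrow> j \<le> int n"
  using p_powi_mem_iff[of "int n"] by simp

lemma Delta_square_mem: "\<Delta> * \<Delta> \<in> \<pp> 0"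
  using Delta_square by (simp add: val_ring_eq power2_eq_square)

lemmas Delta_square_K [simp] = frac_ideal_K[OF Delta_square_mem]

text \<open>If \<open>b' - b\<close> were nonzero, \<open>\<Delta>\<close> would be a quotient of
  elements of \<open>K\<close>.\<close>

lemma coords_unique:
  assumes "a \<in> K" "b \<in> K" "a' \<in> K" "b' \<in> K" "a + b * \<Delta> = a' + b' * \<Delta>"
  shows "a = a'" "b = b'"
proof -
  have "(b' - b) * \<Delta> = a - a'" using assms(5) by (simp add: algebra_simps)
  then have "b' - b \<noteq> 0 \<Longrightarrow> \<Delta> = (a - a') / (b' - b)"
    by (simp add: field_simps)
  moreover have "(a - a') / (b' - b) \<in> K" using assms by simp
  ultimately show "b = b'" using Delta_not_K by auto
  then show "a = a'" using assms(5) by simp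
qed

text \<open>The elements \<open>a + b * \<Delta>\<close> are closed under products because
  \<open>\<Delta> * \<Delta>\<close> is in \<open>K\<close>, and under inverses through the
  conjugate. They form a subfield containing \<open>K\<close> and \<open>\<Delta>\<close>, hence
  everything.\<close>

lemma coords_exist: obtains a b where "a \<in> K" "b \<in> K" "z = a + b * \<Delta>"
proof -
  let ?E = "{a + b * \<Delta> | a b. a \<in> K \<and> b \<in> K}"
  have E: "a \<in> K \<Longrightarrow> b \<in> K \<Longrightarrow> z = a + b * \<Delta> \<Longrightarrow> z \<in> ?E" for a b z
    by blast
  have "inverse z \<in> ?E" if z: "z \<in> ?E" for z
  proof -
    obtain a b where ab: "a \<in> K" "b \<in> K" "z = a + b * \<Delta>" using z by blast
    show ?thesis
    proof (cases "z = 0")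
      case False
      \<comment> \<open>The norm of \<open>z\<close>, nonzero because neither \<open>z\<close> nor
        its conjugate vanishes.\<close>
      define N where "N = a * a - b * b * (\<Delta> * \<Delta>)"
      have zN: "z * (a - b * \<Delta>) = N" by (simp add: ab N_def algebra_simps)
      have "a - b * \<Delta> \<noteq> 0"
        using coords_unique[of a "- b" 0 0] ab False by auto
      then have "N \<noteq> 0" using zN False by auto
      then have "inverse z = a / N + (- b / N) * \<Delta>"
        using zN False by (simp add: field_simps)
      then show ?thesis using ab by (intro E[of "a / N" "- b / N"]) (auto simp: N_def)
    qed (use E[of 0 0] in simp)
  qed
  moreover have "x - y \<in> ?E" if xy: "x \<in> ?E" "y \<in> ?E" for x y
  proof -
    obtain a b a' b' where "a \<in> K" "b \<in> K" "x = a + b * \<Delta>" "a' \<in> K" "b' \<in> K" "y = a' + b' * \<Delta>"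
      using xy by blast
    then show ?thesis by (intro E[of "a - a'" "b - b'"]) (auto simp: algebra_simps)
  qed
  moreover have "x * y \<in> ?E" if xy: "x \<in> ?E" "y \<in> ?E" for x y
  proof -
    obtain a b a' b' where "a \<in> K" "b \<in> K" "x = a + b * \<Delta>" "a' \<in> K" "b' \<in> K" "y = a' + b' * \<Delta>"
      using xy by blast
    then show ?thesis
      by (intro E[of "a * a' + b * b' * (\<Delta> * \<Delta>)" "a * b' + b * a'"]) (simp_all, simp add: algebra_simps)
  qed
  ultimately have "is_subfield ?E"
    using E[of 0 0] E[of 1 0] by (auto simp: is_subfield_def)
  moreover have "K \<subseteq> ?E" using E[of _ 0] by auto
  moreover have "\<Delta> \<in> ?E" using E[of 0 1] by simp
  ultimately have "field_adjoin K \<Delta> \<subseteq> ?E" unfolding field_adjoin_def by blast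
  then show ?thesis using adjoin that by blast
qed

section \<open>Normal form of lattices and homothety classes\<close>

text \<open>
  Up to the scaling by \<open>p\<^sup>b\<close>, this is the lattice with basis \<open>1 + c\<Delta>, p\<^sup>k\<Delta>\<close>.
\<close>

definition lat :: "int \<Rightarrow> 'a \<Rightarrow> int \<Rightarrow> 'a set" where
  "lat b c k = {x + y * \<Delta> | x y. x \<in> \<pp> b \<and> y \<in> K \<and> y - c * x \<in> \<pp> (k + b)}"

lemma mem_lat_iff:
  assumes "x \<in> K" "y \<in> K"
  shows "x + y * \<Delta> \<in> lat b c k \<longleftrightarrow> x \<in> \<pp> b \<and> y - c * x \<in> \<pp> (k + b)"
proof
  assume "x + y * \<Delta> \<in> lat b c k"
  then obtain x' y' where *: "x + y * \<Delta> = x' + y' * \<Delta>" "x' \<in> \<pp> b" "y' \<in> K" "y' - c * x' \<in> \<pp> (k + b)"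
    by (auto simp: lat_def)
  then show "x \<in> \<pp> b \<and> y - c * x \<in> \<pp> (k + b)"
    using coords_unique[OF assms frac_ideal_K[OF *(2)] *(3,1)] by simp
qed (use assms in \<open>auto simp: lat_def\<close>)

lemma lat_eqI:
  assumes "\<And>x y. x \<in> K \<Longrightarrow> y \<in> K \<Longrightarrow> x + y * \<Delta> \<in> A \<longleftrightarrow> x \<in> \<pp> b \<and> y - c * x \<in> \<pp> (k + b)"
  shows "A = lat b c k"
proof (rule set_eqI)
  fix z
  obtain x y where "x \<in> K" "y \<in> K" "z = x + y * \<Delta>" by (rule coords_exist)
  then show "z \<in> A \<longleftrightarrow> z \<in> lat b c k" using assms mem_lat_iff by simp
qed

lemma mem_scale_iff: "s \<noteq> 0 \<Longrightarrow> z \<in> (*) s ` A \<longleftrightarrow> z / s \<in> A" for s z :: 'a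
  by (auto simp: image_iff intro!: bexI[of _ "z / s"])

lemma scale_lat:
  assumes "s \<in> K" "s \<noteq> 0" "c \<in> K"
  shows "(*) s ` lat b c k = lat (b + v s) c k"
proof (rule lat_eqI)
  fix x y assume xy: "x \<in> K" "y \<in> K"
  have "x + y * \<Delta> \<in> (*) s ` lat b c k \<longleftrightarrow> x / s + (y / s) * \<Delta> \<in> lat b c k"
    using assms by (simp add: mem_scale_iff add_divide_distrib)
  also have "\<dots> \<longleftrightarrow> x / s \<in> \<pp> b \<and> y / s - c * (x / s) \<in> \<pp> (k + b)"
    using xy assms by (intro mem_lat_iff) auto
  also have "x / s \<in> \<pp> b \<longleftrightarrow> x \<in> \<pp> (b + v s)"
    using mult_mem_frac_ideal_iff[of s "x / s" "b + v s"] assms xy by simp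
  also have "y / s - c * (x / s) \<in> \<pp> (k + b) \<longleftrightarrow> y - c * x \<in> \<pp> (k + (b + v s))"
    using mult_mem_frac_ideal_iff[of s "y / s - c * (x / s)" "k + (b + v s)"] assms xy
    by (simp add: algebra_simps)
  finally show "x + y * \<Delta> \<in> (*) s ` lat b c k \<longleftrightarrow> x \<in> \<pp> (b + v s) \<and> y - c * x \<in> \<pp> (k + (b + v s))" .
qed

lemma lat_shift_subset:
  assumes "lat a c k \<subseteq> lat b c' k'" "c \<in> K" "c' \<in> K"
  shows "lat (a + t) c k \<subseteq> lat (b + t) c' k'"
  using image_mono[OF assms(1), of "(*) (p powi t)"] assms(2,3) by (simp add: scale_lat)

text \<open>Exchanging \<open>c\<close> and \<open>c'\<close> alters \<open>y - c * x\<close> by a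
  multiple of \<open>c - c'\<close> that lies in \<open>\<pp> (k + b)\<close> as soon as
  \<open>x\<close> is in \<open>\<pp> b\<close>.\<close>

lemma lat_cong:
  assumes "c \<in> K" "c' \<in> K" "c - c' \<in> \<pp> k"
  shows "lat b c k = lat b c' k"
proof (rule lat_eqI)
  fix x y assume xy: "x \<in> K" "y \<in> K"
  have "y - c * x \<in> \<pp> (k + b) \<longleftrightarrow> y - c' * x \<in> \<pp> (k + b)" if x: "x \<in> \<pp> b"
  proof -
    have d: "(c - c') * x \<in> \<pp> (k + b)" using frac_ideal_mult[OF assms(3) x] by simp
    show ?thesis
      using frac_ideal_add[OF _ d, of "y - c * x"] frac_ideal_diff[OF _ d, of "y - c' * x"]
      by (auto simp: algebra_simps)
  qed
  then show "x + y * \<Delta> \<in> lat b c k \<longleftrightarrow> x \<in> \<pp> b \<and> y - c' * x \<in> \<pp> (k + b)"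
    using mem_lat_iff[OF xy] by auto
qed

text \<open>Scaling by an element of valuation \<open>t\<close> only shifts \<open>b\<close> by
  \<open>t\<close>, so letting \<open>b\<close> run over all integers gives the whole homothety
  class; \<open>c\<close> and \<open>k\<close> survive as its parameters.\<close>

definition vertex :: "'a \<Rightarrow> int \<Rightarrow> 'a set set" where
  "vertex c k = range (\<lambda>b. lat b c k)"

lemma homothety_class_lat:
  assumes "c \<in> K"
  shows "homothety_class K (lat b c k) = vertex c k"
proof -
  have "lat b' c k \<in> homothety_class K (lat b c k)" for b'
    using scale_lat[of "p powi (b' - b)" c b k] assms
    by (auto simp: homothety_class_def intro!: exI[of _ "p powi (b' - b)"])
  then show ?thesis
    using scale_lat assms by (auto simp: homothety_class_def vertex_def)
qed

lemma vertex_cong: "c \<in> K \<Longrightarrow> c' \<in> K \<Longrightarrow> c - c' \<in> \<pp> k \<Longrightarrow> vertex c k = vertex c' k"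
  unfolding vertex_def by (intro image_cong refl lat_cong)

text \<open>The system for the coefficients is triangular, with solution \<open>t = x / a\<close>
  and \<open>r = (y - b / a * x) / e\<close>. Integrality of \<open>t\<close> and \<open>r\<close>
  is the membership condition of \<open>lat\<close>.\<close>

lemma two_generators_eq_lat:
  assumes a: "a \<in> K" "a \<noteq> 0" and b: "b \<in> K" and e: "e \<in> K" "e \<noteq> 0"
  shows "{t * (a + b * \<Delta>) + r * (e * \<Delta>) | t r. t \<in> \<pp> 0 \<and> r \<in> \<pp> 0}
    = lat (v a) (b / a) (v e - v a)" (is "?A = _")
proof (rule lat_eqI)
  fix x y assume xy: "x \<in> K" "y \<in> K"
  show "x + y * \<Delta> \<in> ?A \<longleftrightarrow> x \<in> \<pp> (v a) \<and> y - b / a * x \<in> \<pp> (v e - v a + v a)"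
  proof
    assume "x + y * \<Delta> \<in> ?A"
    then obtain t r where tr: "x + y * \<Delta> = t * (a + b * \<Delta>) + r * (e * \<Delta>)" "t \<in> \<pp> 0" "r \<in> \<pp> 0"
      by blast
    then have K: "t \<in> K" "r \<in> K" using frac_ideal_K by auto
    have "x + y * \<Delta> = t * a + (t * b + r * e) * \<Delta>" using tr by (simp add: algebra_simps)
    then have "x = t * a" "y = t * b + r * e"
      using coords_unique[of x y "t * a" "t * b + r * e"] xy K a b e by auto
    then show "x \<in> \<pp> (v a) \<and> y - b / a * x \<in> \<pp> (v e - v a + v a)"
      using frac_ideal_mult[OF tr(2) mem_frac_ideal_val, of a "v a"]
        frac_ideal_mult[OF tr(3) mem_frac_ideal_val, of e "v e"] a e by simp
  next
    assume *: "x \<in> \<pp> (v a) \<and> y - b / a * x \<in> \<pp> (v e - v a + v a)"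
    then have "x / a \<in> \<pp> 0" "(y - b / a * x) / e \<in> \<pp> 0"
      using frac_ideal_divide[of x 0 a] frac_ideal_divide[of "y - b / a * x" 0 e] a e by auto
    moreover have "x + y * \<Delta> = x / a * (a + b * \<Delta>) + (y - b / a * x) / e * (e * \<Delta>)"
      using a e by (simp add: field_simps)
    ultimately show "x + y * \<Delta> \<in> ?A" by blast
  qed
qed

lemma lat_is_lattice:
  assumes "c \<in> K"
  shows "is_lattice K v (lat 0 c k)"
proof -
  let ?S = "{1 + c * \<Delta>, p powi k * \<Delta>}"
  \<comment> \<open>\<open>lin_span\<close> sums over a set, so the sum splits into two terms only
    once the generators are known to differ.\<close>
  have "1 + c * \<Delta> \<noteq> 0 + p powi k * \<Delta>"
    using coords_unique[of 1 c 0 "p powi k"] assms by auto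
  then have ne: "1 + c * \<Delta> \<noteq> p powi k * \<Delta>" by simp
  have span: "lin_span A ?S = {t * (1 + c * \<Delta>) + r * (p powi k * \<Delta>) | t r. t \<in> A \<and> r \<in> A}" for A
  proof -
    have "t * (1 + c * \<Delta>) + r * (p powi k * \<Delta>) \<in> lin_span A ?S" if "t \<in> A" "r \<in> A" for t r
      unfolding lin_span_def using that ne
      by (intro CollectI exI[of _ "\<lambda>s. if s = 1 + c * \<Delta> then t else r"]) auto
    moreover have "lin_span A ?S \<subseteq> {t * (1 + c * \<Delta>) + r * (p powi k * \<Delta>) | t r. t \<in> A \<and> r \<in> A}"
      unfolding lin_span_def using ne by auto
    ultimately show ?thesis by blast
  qed
  have "lin_span (val_ring K v) ?S = lat 0 c k"
    using two_generators_eq_lat[of 1 c "p powi k"] assms by (simp add: span val_ring_eq)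
  moreover have "z \<in> lin_span K ?S" for z
  proof -
    obtain x y where xy: "x \<in> K" "y \<in> K" "z = x + y * \<Delta>" by (rule coords_exist)
    have "z = x * (1 + c * \<Delta>) + ((y - x * c) / p powi k) * (p powi k * \<Delta>)"
    proof -
      have "((y - x * c) / q) * (q * \<Delta>) = (y - x * c) * \<Delta>" if "q \<noteq> 0" for q
        using that by simp
      from this[OF p_powi_nz] show ?thesis unfolding xy by (simp add: algebra_simps)
    qed
    moreover have "(y - x * c) / p powi k \<in> K" using xy assms by simp
    ultimately show ?thesis using xy(1) unfolding span by blast
  qed
  ultimately show ?thesis unfolding is_lattice_def
    by (intro exI[of _ ?S]) auto
qed

text \<open>Column reduction over a discrete valuation ring. A generator \<open>w\<close> whose
  first coordinate has least valuation clears the first coordinate of all others; the remainders are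
  multiples of \<open>\<Delta>\<close>, and one of least valuation generates them.\<close>

lemma lattice_eq_lat:
  assumes "is_lattice K v \<Lambda>"
  obtains b c k where "c \<in> K" "\<Lambda> = lat b c k"
proof -
  obtain S where S: "finite S" "\<Lambda> = lin_span (\<pp> 0) S" "lin_span K S = UNIV"
    using assms by (auto simp: is_lattice_def val_ring_eq)
  have "\<forall>s. \<exists>x y. x \<in> K \<and> y \<in> K \<and> s = x + y * \<Delta>"
    using coords_exist by metis
  then obtain X Y where XY: "\<And>s. X s \<in> K" "\<And>s. Y s \<in> K" "\<And>s. s = X s + Y s * \<Delta>"
    by metis
  have sum_coords: "(\<Sum>s\<in>S. f s * s) = (\<Sum>s\<in>S. f s * g s) * w + (\<Sum>s\<in>S. f s * h s) * \<Delta>"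
    if "\<And>s. s \<in> S \<Longrightarrow> s = g s * w + h s * \<Delta>" for f g h w
  proof -
    have "(\<Sum>s\<in>S. f s * s) = (\<Sum>s\<in>S. f s * g s * w + f s * h s * \<Delta>)"
      by (rule sum.cong[OF refl], subst (2) that, assumption, simp add: algebra_simps)
    then show ?thesis by (simp add: sum.distrib sum_distrib_right)
  qed
  let ?S1 = "{s \<in> S. X s \<noteq> 0}"
  \<comment> \<open>Otherwise all generators would lie on the line \<open>K * \<Delta>\<close>, and
    1 would not be in their span.\<close>
  have "?S1 \<noteq> {}"
  proof
    assume e: "?S1 = {}"
    obtain f where f: "1 = (\<Sum>s\<in>S. f s * s)" "\<forall>s\<in>S. f s \<in> K"
      using S(3) unfolding lin_span_def by blast
    have "s = 0 * 1 + Y s * \<Delta>" if "s \<in> S" for s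
      using XY(3)[of s] e that by auto
    from sum_coords[of "\<lambda>_. 0" 1 Y, OF this]
    have "1 + 0 * \<Delta> = 0 + (\<Sum>s\<in>S. f s * Y s) * \<Delta>" using f(1) by simp
    then show False
      using coords_unique[of 1 0 0 "\<Sum>s\<in>S. f s * Y s"] f XY by (simp add: sum_K)
  qed
  then obtain w where w: "w \<in> ?S1" "\<And>s. s \<in> ?S1 \<Longrightarrow> v (X w) \<le> v (X s)"
    using S(1) ex_is_arg_min_if_finite[of ?S1 "\<lambda>s. v (X s)"] unfolding is_arg_min_linorder by auto
  then have wS: "w \<in> S" "X w \<noteq> 0" by auto
  \<comment> \<open>What is left of \<open>s\<close> at \<open>\<Delta>\<close> after subtracting
    the multiple of \<open>w\<close> that cancels its first coordinate; the multiplier is integral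
    by the choice of \<open>w\<close>.\<close>
  define E where "E s = Y s - X s / X w * Y w" for s
  have EK: "E s \<in> K" for s by (simp add: E_def XY)
  have Es: "s = X s / X w * w + E s * \<Delta>" for s
  proof -
    have "X s / X w * w + E s * \<Delta> = X s / X w * (X w + Y w * \<Delta>) + E s * \<Delta>"
      using XY(3)[of w] by simp
    also have "\<dots> = X s + Y s * \<Delta>" using wS by (simp add: E_def field_simps)
    finally show ?thesis using XY(3)[of s] by simp
  qed
  let ?S2 = "{s \<in> S. E s \<noteq> 0}"
  \<comment> \<open>Otherwise the span would be the line \<open>K * w\<close>. Then
    \<open>\<Delta>\<close> would be a multiple of \<open>w\<close>, which is impossible as
    \<open>X w\<close> is nonzero.\<close>
  have "?S2 \<noteq> {}"
  proof
    assume e: "?S2 = {}"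
    obtain f where f: "\<Delta> = (\<Sum>s\<in>S. f s * s)" "\<forall>s\<in>S. f s \<in> K"
      using S(3) unfolding lin_span_def by blast
    define t where "t = (\<Sum>s\<in>S. f s * (X s / X w))"
    have tK: "t \<in> K" unfolding t_def using f XY by (intro sum_K) auto
    have "s = X s / X w * w + 0 * \<Delta>" if "s \<in> S" for s
      using Es[of s] e that by auto
    from sum_coords[of "\<lambda>s. X s / X w" w "\<lambda>_. 0", OF this]
    have "\<Delta> = t * w" using f(1) by (simp add: t_def)
    then have "\<Delta> = t * (X w + Y w * \<Delta>)" using XY(3)[of w] by simp
    then have eq: "0 + 1 * \<Delta> = t * X w + (t * Y w) * \<Delta>" by (simp add: algebra_simps)
    have "0 = t * X w" "1 = t * Y w"
      using coords_unique[OF _ _ _ _ eq] tK XY by auto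
    then show False using wS by simp
  qed
  then obtain u where u: "u \<in> ?S2" "\<And>s. s \<in> ?S2 \<Longrightarrow> v (E u) \<le> v (E s)"
    using S(1) ex_is_arg_min_if_finite[of ?S2 "\<lambda>s. v (E s)"] unfolding is_arg_min_linorder by auto
  then have uS: "u \<in> S" "E u \<noteq> 0" by auto
  have g: "X s / X w \<in> \<pp> 0" if "s \<in> S" for s
    using that w(2)[of s] wS XY by (intro frac_ideal_divide) (auto simp: frac_ideal_def)
  have h: "E s / E u \<in> \<pp> 0" if "s \<in> S" for s
    using that u(2)[of s] uS EK by (intro frac_ideal_divide) (auto simp: frac_ideal_def)
  let ?A = "{t * (X w + Y w * \<Delta>) + r * (E u * \<Delta>) | t r. t \<in> \<pp> 0 \<and> r \<in> \<pp> 0}"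
  have wXY: "X w + Y w * \<Delta> = w" using XY(3)[of w] by simp
  have "\<Lambda> \<subseteq> ?A"
  proof
    fix z assume "z \<in> \<Lambda>"
    then obtain f where f: "z = (\<Sum>s\<in>S. f s * s)" "\<forall>s\<in>S. f s \<in> \<pp> 0"
      using S(2) by (auto simp: lin_span_def)
    have "z = (\<Sum>s\<in>S. f s * (X s / X w)) * w + (\<Sum>s\<in>S. f s * E s) * \<Delta>"
      unfolding f(1) by (rule sum_coords) (rule Es)
    also have "(\<Sum>s\<in>S. f s * E s) = (\<Sum>s\<in>S. f s * (E s / E u)) * E u"
      using uS by (simp add: sum_distrib_right)
    finally have "z = (\<Sum>s\<in>S. f s * (X s / X w)) * (X w + Y w * \<Delta>)
      + (\<Sum>s\<in>S. f s * (E s / E u)) * (E u * \<Delta>)" unfolding wXY by (simp add: mult.assoc)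
    moreover have "(\<Sum>s\<in>S. f s * (X s / X w)) \<in> \<pp> 0" "(\<Sum>s\<in>S. f s * (E s / E u)) \<in> \<pp> 0"
      using f(2) g h frac_ideal_mult[of _ 0 _ 0 0] by (simp_all only: frac_ideal_sum add_0 order_refl)
    ultimately show "z \<in> ?A" by blast
  qed
  moreover have "?A \<subseteq> \<Lambda>"
  proof
    fix z assume "z \<in> ?A"
    then obtain t r where tr: "z = t * w + r * (E u * \<Delta>)" "t \<in> \<pp> 0" "r \<in> \<pp> 0"
      unfolding wXY by blast
    define q where "q = X u / X w"
    \<comment> \<open>The coefficients of \<open>z = (t - r * q) * w + r * u\<close>, written as a
      sum of two indicator terms so that \<open>u\<close> and \<open>w\<close> need not be
      compared.\<close>
    define f where "f s = (if s = w then t - r * q else 0) + (if s = u then r else 0)" for s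
    have "E u * \<Delta> = u - q * w" using Es[of u] by (simp add: q_def algebra_simps)
    then have "z = t * w + r * (u - q * w)" using tr(1) by simp
    then have z: "z = (t - r * q) * w + r * u" by (simp add: algebra_simps)
    have "(\<Sum>s\<in>S. f s * s) = (\<Sum>s\<in>S. (if s = w then (t - r * q) * w else 0) + (if s = u then r * u else 0))"
      by (rule sum.cong) (auto simp: f_def algebra_simps)
    also have "\<dots> = z" using S(1) wS uS z by (simp add: sum.distrib)
    finally have "z = (\<Sum>s\<in>S. f s * s)" ..
    moreover have "f s \<in> \<pp> 0" for s
      using tr g[OF uS(1)] frac_ideal_mult[of r 0 q 0 0]
      by (auto simp: f_def q_def intro!: frac_ideal_add frac_ideal_diff)
    ultimately show "z \<in> \<Lambda>" using S(2) by (auto simp: lin_span_def)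
  qed
  ultimately have "\<Lambda> = ?A" by blast
  also have "?A = lat (v (X w)) (Y w / X w) (v (E u) - v (X w))"
    using XY wS uS EK by (intro two_generators_eq_lat) auto
  finally show ?thesis using that[of "Y w / X w"] XY by simp
qed

lemma bt_vertices_eq: "bt_vertices K v = {vertex c k | c k. c \<in> K}"
proof -
  have "vertex c k \<in> bt_vertices K v" if "c \<in> K" for c k
    using homothety_class_lat[OF that] lat_is_lattice[OF that, of k]
    unfolding bt_vertices_def by fastforce
  moreover have "\<exists>c k. x = vertex c k \<and> c \<in> K" if "x \<in> bt_vertices K v" for x
    using that lattice_eq_lat homothety_class_lat unfolding bt_vertices_def
    by (smt (verit, best) mem_Collect_eq)
  ultimately show ?thesis by blast
qed

text \<open>One inclusion is Horner's rule: multiplication by \<open>p ^ m * \<Delta>\<close>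
  preserves the lattice because \<open>\<Delta> * \<Delta>\<close> is integral. For the other,
  linear polynomials suffice.\<close>

lemma quad_order_eq: "quad_order K v p \<Delta> m = lat 0 0 (int m)"
proof -
  have eq: "lat 0 0 (int m) = {x + y * \<Delta> | x y. x \<in> \<pp> 0 \<and> y \<in> \<pp> (int m)}"
    using frac_ideal_K by (auto simp: lat_def)
  have "poly f (p ^ m * \<Delta>) \<in> lat 0 0 (int m)" if "\<forall>i. coeff f i \<in> \<pp> 0" for f
    using that
  proof (induction f rule: pCons_induct)
    case 0
    have "0 = 0 + 0 * \<Delta>" by simp
    then show ?case unfolding eq poly_0 using zero_frac_ideal by blast
  next
    case (pCons a f)
    have "coeff f i \<in> \<pp> 0" for i using pCons.prems[rule_format, of "Suc i"] by simp
    then obtain x y where xy: "poly f (p ^ m * \<Delta>) = x + y * \<Delta>" "x \<in> \<pp> 0" "y \<in> \<pp> (int m)"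
      using pCons.IH unfolding eq by auto
    have a: "a \<in> \<pp> 0" using pCons.prems[rule_format, of 0] by simp
    have "p ^ m * y \<in> \<pp> 0" "p ^ m * x \<in> \<pp> (int m)"
      using xy by (auto intro: frac_ideal_mult[where j = "int m"] simp: p_power_mem_iff)
    then have "a + p ^ m * y * (\<Delta> * \<Delta>) \<in> \<pp> 0" "p ^ m * x \<in> \<pp> (int m)"
      using a Delta_square_mem by (auto intro!: frac_ideal_add frac_ideal_mult[of _ 0 _ 0])
    moreover have "poly (pCons a f) (p ^ m * \<Delta>) = (a + p ^ m * y * (\<Delta> * \<Delta>)) + p ^ m * x * \<Delta>"
      using xy(1) by (simp add: algebra_simps)
    ultimately show ?case unfolding eq by blast
  qed
  moreover have "x + y * \<Delta> \<in> ring_adjoin (\<pp> 0) (p ^ m * \<Delta>)" if "x \<in> \<pp> 0" "y \<in> \<pp> (int m)" for x y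
  proof -
    have "y / p ^ m \<in> \<pp> 0" using that by (intro frac_ideal_divide) (auto simp: val_power)
    then have "\<forall>i. coeff [:x, y / p ^ m:] i \<in> \<pp> 0"
      using that by (auto simp: coeff_pCons split: nat.split)
    moreover have "poly [:x, y / p ^ m:] (p ^ m * \<Delta>) = x + y * \<Delta>" by simp
    ultimately show ?thesis unfolding ring_adjoin_def
      by (intro CollectI exI[of _ "[:x, y / p ^ m:]"]) auto
  qed
  ultimately show ?thesis
    unfolding quad_order_def val_ring_eq by (auto simp: eq ring_adjoin_def)
qed

lemma lat_mono: "b \<le> b' \<Longrightarrow> k + b \<le> k' + b' \<Longrightarrow> lat b' c k' \<subseteq> lat b c k"
  unfolding lat_def using frac_ideal_mono by blast

text \<open>The inclusion is tested on the two basis vectors of the smaller lattice,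
  \<open>p powi b'\<close> times \<open>1 + c' * \<Delta>\<close> and
  \<open>p powi (k' + b') * \<Delta>\<close>.\<close>

lemma lat_subsetD:
  assumes "lat b' c' k' \<subseteq> lat b c k" "c \<in> K" "c' \<in> K"
  shows "b \<le> b'" "k + b \<le> k' + b'" "c' - c \<in> \<pp> (k + b - b')"
proof -
  have "p powi b' + (c' * p powi b') * \<Delta> \<in> lat b' c' k'"
    using assms by (subst mem_lat_iff) (auto simp: p_powi_mem_iff)
  with assms(1) have "p powi b' + (c' * p powi b') * \<Delta> \<in> lat b c k" by blast
  then have *: "p powi b' \<in> \<pp> b" "c' * p powi b' - c * p powi b' \<in> \<pp> (k + b)"
    using assms by (simp_all add: mem_lat_iff)
  show "b \<le> b'" using *(1) by (simp add: p_powi_mem_iff)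
  have "p powi b' * (c' - c) \<in> \<pp> (k + b)" using *(2) by (simp add: algebra_simps)
  then show "c' - c \<in> \<pp> (k + b - b')"
    using mult_mem_frac_ideal_iff[of "p powi b'" "c' - c" "k + b"] assms by simp
  have "0 + p powi (k' + b') * \<Delta> \<in> lat b' c' k'"
    by (subst mem_lat_iff) (auto simp: p_powi_mem_iff)
  with assms(1) have "0 + p powi (k' + b') * \<Delta> \<in> lat b c k" by blast
  then have "p powi (k' + b') \<in> \<pp> (k + b)"
    by (subst (asm) mem_lat_iff) auto
  then show "k + b \<le> k' + b'" by (simp add: p_powi_mem_iff)
qed

lemma lat_psubset:
  assumes "c \<in> K" "b \<le> b'" "k + b \<le> k' + b'" "b < b' \<or> k + b < k' + b'"
  shows "lat b' c k' \<subset> lat b c k"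
  using lat_mono[of b b' k k' c] lat_subsetD(1,2)[of b c k b' c k'] assms by auto

section \<open>Arcs and explicit walks in the tree\<close>

lemma vertex_in_verts: "c \<in> K \<Longrightarrow> vertex c k \<in> verts (bt_tree K v p)"
  by (auto simp: bt_tree_def bt_vertices_eq)

text \<open>Both arcs come from the chain \<open>lat 1 c (k + 1)\<close>, \<open>lat 1 c k\<close>,
  \<open>lat 0 c (k + 1)\<close>, \<open>lat 0 c k\<close> of increasing lattices, in which
  \<open>p\<close> raises the first index by one.\<close>

lemma arc_succ:
  assumes "c \<in> K"
  shows "(vertex c k, vertex c (k + 1)) \<in> arcs (bt_tree K v p)"
    and "(vertex c (k + 1), vertex c k) \<in> arcs (bt_tree K v p)"
proof -
  have in_vertex: "lat b c k \<in> vertex c k" for b k by (auto simp: vertex_def)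
  have "(*) p ` lat 0 c k \<subset> lat 0 c (k + 1)" "lat 0 c (k + 1) \<subset> lat 0 c k"
    "(*) p ` lat 0 c (k + 1) \<subset> lat 1 c k" "lat 1 c k \<subset> lat 0 c (k + 1)"
    using assms by (simp_all add: scale_lat lat_psubset)
  then show "(vertex c k, vertex c (k + 1)) \<in> arcs (bt_tree K v p)"
    and "(vertex c (k + 1), vertex c k) \<in> arcs (bt_tree K v p)"
    using assms in_vertex unfolding bt_tree_def bt_vertices_eq by auto
qed

interpretation bt: wf_digraph "bt_tree K v p"
  by (rule wf_digraph_bt_tree)

lemma arc_simps [simp]: "tail (bt_tree K v p) = fst" "head (bt_tree K v p) = snd"
  by (simp_all add: bt_tree_def)

lemma walk_down:
  assumes "c \<in> K"
  shows "\<exists>es. bt.awalk (vertex c (k + int l)) es (vertex c k) \<and> length es = l"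
proof (induction l)
  case 0
  then show ?case using vertex_in_verts[OF assms] by (auto simp: bt.awalk_Nil_iff)
next
  case (Suc l)
  then obtain es where es: "bt.awalk (vertex c (k + int l)) es (vertex c k)" "length es = l" by blast
  then show ?case
    using arc_succ(2)[OF assms, of "k + int l"] vertex_in_verts[OF assms]
    by (intro exI[of _ "(vertex c (k + int (Suc l)), vertex c (k + int l)) # es"])
      (simp add: bt.awalk_Cons_iff algebra_simps)
qed

lemma walk_up:
  assumes "c \<in> K"
  shows "\<exists>es. bt.awalk (vertex c k) es (vertex c (k + int l)) \<and> length es = l"
proof (induction l)
  case 0
  then show ?case using vertex_in_verts[OF assms] by (auto simp: bt.awalk_Nil_iff)
next
  case (Suc l)
  then obtain es where es: "bt.awalk (vertex c k) es (vertex c (k + int l))" "length es = l" by blast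
  then show ?case
    using arc_succ(1)[OF assms, of "k + int l"] vertex_in_verts[OF assms]
    by (intro exI[of _ "es @ [(vertex c (k + int l), vertex c (k + int (Suc l)))]"])
      (simp add: bt.awalk_simps algebra_simps)
qed

text \<open>The walk descends from level \<open>k\<close> to level \<open>j\<close>, where
  \<open>c\<close> is congruent to 0 and the vertex becomes \<open>vertex 0 j\<close>, and then
  climbs to level \<open>m\<close>. The intermediate stop \<open>i\<close> serves to show that
  \<open>vertex 0 (m - 1)\<close> can lie on such a walk.\<close>

lemma walk_through:
  assumes "c \<in> \<pp> j" "j \<le> k" "j \<le> i" "i \<le> m"
  shows "\<exists>es. bt.awalk (vertex c k) es (vertex 0 m) \<and> int (length es) = k + m - 2 * j
    \<and> vertex 0 i \<in> set (bt.awalk_verts (vertex c k) es)"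
proof -
  have c: "c \<in> K" using assms frac_ideal_K by blast
  have "vertex c j = vertex 0 j" using assms c by (intro vertex_cong) auto
  then obtain es1 where es1: "bt.awalk (vertex c k) es1 (vertex 0 j)" "length es1 = nat (k - j)"
    using walk_down[OF c, of j "nat (k - j)"] assms by auto
  obtain es2 where es2: "bt.awalk (vertex 0 j) es2 (vertex 0 i)" "length es2 = nat (i - j)"
    using walk_up[of 0 j "nat (i - j)"] assms by auto
  obtain es3 where es3: "bt.awalk (vertex 0 i) es3 (vertex 0 m)" "length es3 = nat (m - i)"
    using walk_up[of 0 i "nat (m - i)"] assms by auto
  have w: "bt.awalk (vertex c k) (es1 @ es2 @ es3) (vertex 0 m)"
    using es1 es2 es3 by (blast intro: bt.awalk_appendI)
  have "vertex 0 i \<in> set (bt.awalk_verts (vertex 0 i) es3)"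
    using bt.hd_in_awalk_verts(1)[OF es3(1)] .
  then have "vertex 0 i \<in> set (bt.awalk_verts (vertex c k) (es1 @ es2 @ es3))"
    using bt.set_awalk_verts_append es1 es2 es3 bt.awalk_appendI by auto
  with w show ?thesis using es1 es2 es3 assms by (intro exI[of _ "es1 @ es2 @ es3"]) auto
qed

section \<open>Lower bounds for walks and the distance formula\<close>

text \<open>
  A walk of length \<open>l\<close> bounds the elementary divisors of its end relative to its start, which is
  where all lower bounds for distances come from.
\<close>

lemma walk_lat_subset:
  assumes "bt.awalk (vertex c k) es (vertex c' k')" "c \<in> K" "c' \<in> K"
  shows "\<exists>b. lat (int (length es)) c k \<subseteq> lat b c' k' \<and> lat b c' k' \<subseteq> lat 0 c k"
  using assms
proof (induction es arbitrary: c k)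
  case Nil
  then have "vertex c k = vertex c' k'" by (simp add: bt.awalk_Nil_iff)
  moreover have "lat 0 c k \<in> vertex c k" by (auto simp: vertex_def)
  ultimately have "lat 0 c k \<in> vertex c' k'" by simp
  then obtain b where "lat 0 c k = lat b c' k'" unfolding vertex_def by blast
  then show ?case by auto
next
  case (Cons e es)
  then have e: "e \<in> arcs (bt_tree K v p)" "fst e = vertex c k"
    and w: "bt.awalk (snd e) es (vertex c' k')"
    by (auto simp: bt.awalk_Cons_iff)
  have "snd e \<in> bt_vertices K v"
    and "\<exists>\<Lambda>\<in>fst e. \<exists>\<Lambda>'\<in>snd e. (*) p ` \<Lambda> \<subset> \<Lambda>' \<and> \<Lambda>' \<subset> \<Lambda>"
    using e(1) by (simp_all add: bt_tree_def case_prod_unfold)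
  moreover obtain c1 k1 where c1: "snd e = vertex c1 k1" "c1 \<in> K"
    using calculation(1) unfolding bt_vertices_eq by blast
  ultimately obtain a b1 where ab: "(*) p ` lat a c k \<subset> lat b1 c1 k1" "lat b1 c1 k1 \<subset> lat a c k"
    using e(2) unfolding vertex_def by auto
  then have "lat (a + 1) c k \<subseteq> lat b1 c1 k1" "lat b1 c1 k1 \<subseteq> lat a c k"
    using Cons.prems by (auto simp: scale_lat)
  \<comment> \<open>The inclusions given by the first arc, moved to an arbitrary scale
    \<open>t\<close>.\<close>
  from this[THEN lat_shift_subset]
  have step: "lat (1 + t) c k \<subseteq> lat (b1 - a + t) c1 k1" "lat (b1 - a + t) c1 k1 \<subseteq> lat t c k" for t
    using Cons.prems c1 by (metis add.commute add_diff_eq diff_add_cancel)+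
  obtain b where b: "lat (int (length es)) c1 k1 \<subseteq> lat b c' k'" "lat b c' k' \<subseteq> lat 0 c1 k1"
    using Cons.IH[of c1 k1] w c1 Cons.prems by auto
  \<comment> \<open>Shifting by \<open>b1 - a\<close> aligns the lattices of the remaining walk with
    the neighbour that lies inside \<open>lat 0 c k\<close>.\<close>
  from this[THEN lat_shift_subset, of "b1 - a"]
  have "lat (int (length es) + (b1 - a)) c1 k1 \<subseteq> lat (b + (b1 - a)) c' k'"
    "lat (b + (b1 - a)) c' k' \<subseteq> lat (0 + (b1 - a)) c1 k1"
    using c1 Cons.prems by auto
  then have "lat (int (length (e # es))) c k \<subseteq> lat (b + (b1 - a)) c' k'"
    "lat (b + (b1 - a)) c' k' \<subseteq> lat 0 c k"
    using step(1)[of "int (length es)"] step(2)[of 0] by (auto simp: algebra_simps)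
  then show ?case by blast
qed

text \<open>With \<open>l\<close> the length, the slope conditions of the two inclusions give
  \<open>m + b - l \<le> j\<close> and \<open>k - b \<le> j\<close> when \<open>c\<close> is outside
  \<open>\<pp> (j + 1)\<close>; adding them eliminates \<open>b\<close>. Otherwise \<open>j\<close>
  is \<open>k\<close> or \<open>m\<close>, and comparing the indices gives
  \<open>m - k \<le> l\<close> and \<open>k - m \<le> l\<close>.\<close>

lemma walk_length_ge:
  assumes "bt.awalk (vertex c k) es (vertex 0 m)" "c \<in> K"
    and "j = k \<or> j = m \<or> c \<notin> \<pp> (j + 1)"
  shows "k + m - 2 * j \<le> int (length es)"
proof -
  obtain b where b: "lat (int (length es)) c k \<subseteq> lat b 0 m" "lat b 0 m \<subseteq> lat 0 c k"
    using walk_lat_subset[OF assms(1,2)] by auto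
  note D1 = lat_subsetD[OF b(1)] and D2 = lat_subsetD[OF b(2)]
  have *: "b \<le> int (length es)" "m + b \<le> k + int (length es)" "0 \<le> b" "k \<le> m + b"
    using D1 D2 assms by auto
  show ?thesis
  proof (cases "c \<in> \<pp> (j + 1)")
    case False
    have "c \<in> \<pp> (m + b - int (length es))" "- c \<in> \<pp> (k - b)" using D1(3) D2(3) assms by auto
    then have "c \<in> \<pp> (m + b - int (length es))" "c \<in> \<pp> (k - b)"
      using frac_ideal_uminus[of "- c"] by auto
    then have "m + b - int (length es) < j + 1" "k - b < j + 1"
      using False frac_ideal_mono by (meson not_less)+
    then show ?thesis by linarith
  qed (use assms * in auto)
qed

text \<open>
  The conditions say that \<open>j = min(k, m, v(c))\<close>, with \<open>v(0)\<close> read as infinity.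
\<close>

lemma branch_level_exists:
  assumes "c \<in> K"
  obtains j where "j \<le> k" "j \<le> m" "c \<in> \<pp> j" "j = k \<or> j = m \<or> c \<notin> \<pp> (j + 1)"
proof (cases "c = 0")
  case True
  then show ?thesis using that[of "min k m"] by (auto simp: min_def)
next
  case False
  then show ?thesis using that[of "min (min k m) (v c)"] assms
    by (auto simp: frac_ideal_def min_def)
qed

lemma graph_dist_vertex:
  assumes "c \<in> \<pp> j" "j \<le> k" "j \<le> m" "j = k \<or> j = m \<or> c \<notin> \<pp> (j + 1)"
  shows "graph_dist (bt_tree K v p) (vertex c k) (vertex 0 m) = ereal (real_of_int (k + m - 2 * j))"
proof -
  obtain es where es: "bt.awalk (vertex c k) es (vertex 0 m)" "int (length es) = k + m - 2 * j"
    using walk_through[of c j k m m] assms by auto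
  have "length es \<le> length es'" if "bt.awalk (vertex c k) es' (vertex 0 m)" for es'
    using walk_length_ge[OF that frac_ideal_K[OF assms(1)] assms(4)] es(2) by linarith
  then have "graph_dist (bt_tree K v p) (vertex c k) (vertex 0 m) = ereal (real (length es))"
    using es(1) by (intro bt.graph_dist_eqI)
  moreover have "real (length es) = real_of_int (k + m - 2 * j)"
    by (simp only: es(2)[symmetric] of_int_of_nat_eq)
  ultimately show ?thesis by simp
qed

text \<open>Let \<open>j\<close> be the level where the walk from \<open>vertex c k\<close> stops
  descending. If \<open>j < m\<close>, some geodesic climbs through level \<open>m - 1\<close>; so
  avoidance forces \<open>j = m\<close>, and the distance then gives
  \<open>k = m + d\<close>.\<close>

lemma sphere_away_from_predecessor:
  "{x \<in> verts (bt_tree K v p).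
      graph_dist (bt_tree K v p) x (vertex 0 m) = ereal (real d) \<and>
      (\<forall>es. is_geodesic (bt_tree K v p) x es (vertex 0 m) \<longrightarrow>
         vertex 0 (m - 1) \<notin> set (bt.awalk_verts x es))}
   = {vertex c (m + int d) | c. c \<in> \<pp> m}" (is "?A = ?B")
proof (intro equalityI subsetI)
  fix x assume x: "x \<in> ?A"
  then obtain c k where ck: "x = vertex c k" "c \<in> K"
    by (auto simp: bt_tree_def bt_vertices_eq)
  obtain j where j: "j \<le> k" "j \<le> m" "c \<in> \<pp> j" "j = k \<or> j = m \<or> c \<notin> \<pp> (j + 1)"
    using branch_level_exists[OF ck(2)] .
  have dist: "graph_dist (bt_tree K v p) x (vertex 0 m) = ereal (real_of_int (k + m - 2 * j))"
    using graph_dist_vertex j ck by simp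
  with x have "real_of_int (k + m - 2 * j) = real d" by simp
  then have d: "k + m - 2 * j = int d" by linarith
  have "j = m"
  proof (rule ccontr)
    assume "j \<noteq> m"
    then obtain es where es: "bt.awalk x es (vertex 0 m)" "int (length es) = k + m - 2 * j"
      "vertex 0 (m - 1) \<in> set (bt.awalk_verts x es)"
      using walk_through[of c j k "m - 1" m] j ck by auto
    have "length es = d" using es(2) d by linarith
    then have "is_geodesic (bt_tree K v p) x es (vertex 0 m)"
      using x es(1) by (simp add: is_geodesic_def)
    with x es(3) show False by blast
  qed
  then have "k = m + int d" using d by simp
  then show "x \<in> ?B" using ck j(3) \<open>j = m\<close> by blast
next
  fix x assume "x \<in> ?B"
  then obtain c where c: "x = vertex c (m + int d)" "c \<in> \<pp> m" by blast
  then have cK: "c \<in> K" using frac_ideal_K by blast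
  have dist: "graph_dist (bt_tree K v p) x (vertex 0 m) = ereal (real d)"
    using graph_dist_vertex[of c m "m + int d" m] c by simp
  moreover have "vertex 0 (m - 1) \<notin> set (bt.awalk_verts x es)"
    if geo: "is_geodesic (bt_tree K v p) x es (vertex 0 m)" for es
  proof
    assume "vertex 0 (m - 1) \<in> set (bt.awalk_verts x es)"
    moreover have "bt.awalk x es (vertex 0 m)" "length es = d"
      using geo dist by (auto simp: is_geodesic_def)
    ultimately obtain q r where qr: "es = q @ r" "bt.awalk x q (vertex 0 (m - 1))"
      using bt.awalk_decomp by blast
    \<comment> \<open>By the lower bound with branch level \<open>m - 1\<close>, reaching
      \<open>vertex 0 (m - 1)\<close> already takes \<open>d + 1\<close> steps, more than the whole
      geodesic has.\<close>
    have "m + int d + (m - 1) - 2 * (m - 1) \<le> int (length q)"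
      using walk_length_ge[of c "m + int d" q "m - 1" "m - 1"] qr(2) c cK by simp
    then show False using qr(1) \<open>length es = d\<close> by simp
  qed
  ultimately show "x \<in> ?A" using c cK vertex_in_verts by simp
qed

section \<open>Translates of the orders by units\<close>

text \<open>If the product with \<open>x + y * \<Delta>\<close> is \<open>X + Y * \<Delta>\<close>,
  then \<open>Y - b / a * X = a * N * y\<close>, where \<open>a * a * N\<close> is the norm of
  \<open>a + b * \<Delta>\<close>. As \<open>p\<close> divides \<open>b\<close>, both
  \<open>a\<close> and \<open>N\<close> are units, so the condition on \<open>y\<close> passes to
  \<open>Y - b / a * X\<close> and back.\<close>

lemma unit_scale_lat:
  assumes a: "a - 1 \<in> \<pp> 1" and b: "b \<in> \<pp> 1" and n: "0 \<le> n"
  shows "(*) (a + b * \<Delta>) ` lat 0 0 n = lat 0 (b / a) n"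
proof -
  note a' = unit_of_mem_one_plus[OF a]
  have bK: "b \<in> K" using b frac_ideal_K by blast
  define N where "N = 1 - (b / a) * (b / a) * (\<Delta> * \<Delta>)"
  have ba: "b / a \<in> \<pp> 1" using frac_ideal_divide[of b 1 a] a' b by simp
  have "N - 1 \<in> \<pp> 1"
    unfolding N_def
    using frac_ideal_mult[OF frac_ideal_mult[OF ba ba] Delta_square_mem, of 1 1] frac_ideal_uminus by simp
  note N = unit_of_mem_one_plus[OF this]
  have inverse_mem: "x / t \<in> \<pp> i" if "x \<in> \<pp> i" "t \<in> K" "t \<noteq> 0" "v t = 0" for x t i
    using frac_ideal_divide[of x i t] that by simp
  show ?thesis
  proof (intro equalityI subsetI)
    fix z assume "z \<in> (*) (a + b * \<Delta>) ` lat 0 0 n"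
    then obtain x y where xy: "z = (a + b * \<Delta>) * (x + y * \<Delta>)" "x \<in> \<pp> 0" "y \<in> K" "y \<in> \<pp> n"
      by (auto simp: lat_def)
    define X Y where "X = a * x + b * y * (\<Delta> * \<Delta>)" and "Y = b * x + a * y"
    have "z = X + Y * \<Delta>" by (simp add: xy X_def Y_def algebra_simps)
    moreover have "b * y \<in> \<pp> 0" using frac_ideal_mult[OF b xy(4)] n by simp
    then have "X \<in> \<pp> 0" unfolding X_def
      using frac_ideal_mult[OF a'(4) xy(2), of 0] frac_ideal_mult[OF _ Delta_square_mem, of "b * y" 0 0]
      by (auto intro: frac_ideal_add)
    moreover have "Y - b / a * X = a * N * y"
      using a' by (simp add: X_def Y_def N_def field_simps)
    then have "Y - b / a * X \<in> \<pp> n"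
      using frac_ideal_mult[OF frac_ideal_mult[OF a'(4) N(4)] xy(4), of 0 n] by simp
    moreover have "Y \<in> K" using xy a' bK frac_ideal_K by (simp add: Y_def)
    ultimately show "z \<in> lat 0 (b / a) n" unfolding lat_def by auto
  next
    fix z assume "z \<in> lat 0 (b / a) n"
    then obtain X Y where XY: "z = X + Y * \<Delta>" "X \<in> \<pp> 0" "Y \<in> K" "Y - b / a * X \<in> \<pp> n"
      by (auto simp: lat_def)
    \<comment> \<open>The solution of the linear system for the preimage, with \<open>y\<close>
      found first.\<close>
    define y where "y = (Y - b / a * X) / (a * N)"
    define x where "x = (X - b * y * (\<Delta> * \<Delta>)) / a"
    have y: "y \<in> \<pp> n" unfolding y_def divide_divide_eq_left[symmetric]
      using XY(4) a' N by (intro inverse_mem)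
    have "b * y \<in> \<pp> 0" using frac_ideal_mult[OF b y] n by simp
    then have "X - b * y * (\<Delta> * \<Delta>) \<in> \<pp> 0"
      using XY(2) frac_ideal_mult[OF _ Delta_square_mem, of "b * y" 0 0] by (auto intro: frac_ideal_diff)
    then have x: "x \<in> \<pp> 0" unfolding x_def using a' by (intro inverse_mem)
    have X: "X = a * x + b * y * (\<Delta> * \<Delta>)" using a' by (simp add: x_def)
    have "Y - b / a * X = a * N * y" using a' N by (simp add: y_def)
    then have "Y = b / a * X + a * N * y" by (simp add: algebra_simps)
    also have "\<dots> = b * x + a * y" using a' by (simp add: X N_def field_simps)
    finally have "z = (a + b * \<Delta>) * (x + y * \<Delta>)" by (simp add: XY(1) X algebra_simps)
    moreover have "x + y * \<Delta> \<in> lat 0 0 n" using x y frac_ideal_K by (auto simp: lat_def)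
    ultimately show "z \<in> (*) (a + b * \<Delta>) ` lat 0 0 n" by blast
  qed
qed

lemma u_gen_mult:
  "(a + b * \<Delta>) * u_gen p \<Delta> i t
     = (a + b * t * p ^ i * (\<Delta> * \<Delta>)) + (b + a * t * p ^ i) * \<Delta>"
  by (simp add: u_gen_def algebra_simps)

text \<open>Brings the \<open>u_tuple\<close> elements into the form required by
  \<open>unit_scale_lat\<close>. Each factor changes \<open>a\<close> by a multiple of
  \<open>b\<close>, hence of \<open>p\<close>, and \<open>b\<close> by a multiple of
  \<open>p ^ m\<close>.\<close>

lemma prod_u_gen_coords:
  assumes "\<And>i. i \<in> {m..<m + l} \<Longrightarrow> \<alpha> i \<in> \<pp> 0" "1 \<le> m"
  shows "\<exists>a b. (\<Prod>i\<in>{m..<m + l}. u_gen p \<Delta> i (\<alpha> i)) = a + b * \<Delta> \<and> a - 1 \<in> \<pp> 1 \<and> b \<in> \<pp> (int m)"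
  using assms(1)
proof (induction l)
  case 0
  show ?case by (intro exI[of _ 1] exI[of _ 0]) simp
next
  case (Suc l)
  then obtain a b where ab: "(\<Prod>i\<in>{m..<m + l}. u_gen p \<Delta> i (\<alpha> i)) = a + b * \<Delta>"
    "a - 1 \<in> \<pp> 1" "b \<in> \<pp> (int m)" by auto
  let ?i = "m + l"
  have t: "\<alpha> ?i * p ^ ?i \<in> \<pp> (int m)"
    using Suc.prems[of ?i] by (auto intro: frac_ideal_mult[of _ 0 _ "int ?i"] simp: p_power_mem_iff)
  have "b * (\<alpha> ?i * p ^ ?i) * (\<Delta> * \<Delta>) \<in> \<pp> 1"
    using assms(2) by (intro frac_ideal_mult[OF frac_ideal_mult[OF ab(3) t order_refl] Delta_square_mem]) simp
  from frac_ideal_add[OF ab(2) this]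
  have "(a + b * \<alpha> ?i * p ^ ?i * (\<Delta> * \<Delta>)) - 1 \<in> \<pp> 1"
    by (simp add: algebra_simps)
  moreover have "b + a * \<alpha> ?i * p ^ ?i \<in> \<pp> (int m)"
    using frac_ideal_add[OF ab(3) frac_ideal_mult[OF unit_of_mem_one_plus(4)[OF ab(2)] t, of "int m"]]
    by (simp add: mult.assoc)
  moreover have "(\<Prod>i\<in>{m..<m + Suc l}. u_gen p \<Delta> i (\<alpha> i))
      = (a + b * \<alpha> ?i * p ^ ?i * (\<Delta> * \<Delta>)) + (b + a * \<alpha> ?i * p ^ ?i) * \<Delta>"
    by (simp add: ab(1) u_gen_mult)
  ultimately show ?case by blast
qed

text \<open>
  Successive approximation: modulo \<open>p\<^sup>i\<^sup>+\<^sup>1\<close>, multiplication by \<open>1 + t p\<^sup>i \<Delta>\<close> changes the slope \<open>b / a\<close>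
  of \<open>a + b\<Delta>\<close> by \<open>t p\<^sup>i\<close>, so the digits \<open>t\<close> can be chosen one at a time.
\<close>

lemma prod_u_gen_slope_surj:
  assumes R: "residue_reps K v p R" and m: "1 \<le> m" and c: "c \<in> \<pp> (int m)"
  shows "\<exists>\<alpha> \<in> {m..<m + l} \<rightarrow>\<^sub>E R. \<exists>a b. (\<Prod>i\<in>{m..<m + l}. u_gen p \<Delta> i (\<alpha> i)) = a + b * \<Delta>
    \<and> a - 1 \<in> \<pp> 1 \<and> b \<in> \<pp> (int m) \<and> b - c * a \<in> \<pp> (int (m + l))"
proof (induction l)
  case 0
  \<comment> \<open>Over the empty index range the only extensional function is constantly
    \<open>undefined\<close>.\<close>
  show ?case using c by (intro bexI[of _ "\<lambda>_. undefined"] exI[of _ 1] exI[of _ 0]) auto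
next
  case (Suc l)
  then obtain \<alpha> a b where \<alpha>: "\<alpha> \<in> {m..<m + l} \<rightarrow>\<^sub>E R"
    and ab: "(\<Prod>i\<in>{m..<m + l}. u_gen p \<Delta> i (\<alpha> i)) = a + b * \<Delta>" "a - 1 \<in> \<pp> 1"
      "b \<in> \<pp> (int m)" "b - c * a \<in> \<pp> (int (m + l))" by blast
  note a = unit_of_mem_one_plus[OF ab(2)]
  let ?i = "m + l"
  \<comment> \<open>The exact digit for which \<open>b + a * x0 * p ^ (m + l)\<close> equals
    \<open>c * a\<close>; its representative \<open>t\<close> in \<open>R\<close> leaves an error
    one order smaller.\<close>
  define x0 where "x0 = - (b - c * a) / (a * p ^ ?i)"
  have "v (a * p ^ ?i) = int ?i" using a by (subst val_mult) (auto simp: val_power)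
  then have "x0 \<in> \<pp> 0" unfolding x0_def
    using ab(4) a by (intro frac_ideal_divide) (auto simp del: minus_diff_eq intro!: frac_ideal_uminus)
  then obtain t where t: "t \<in> R" "x0 - t \<in> (*) p ` \<pp> 0" "t \<in> \<pp> 0"
    using R unfolding residue_reps_def val_ring_eq by blast
  have xt: "x0 - t \<in> \<pp> 1" using t(2) frac_ideal_mult[of p 1 _ 0 1] mem_frac_ideal_val[of p] by auto
  define \<beta> where "\<beta> = \<alpha>(?i := t)"
  have \<beta>: "\<beta> \<in> {m..<m + Suc l} \<rightarrow>\<^sub>E R"
    using \<alpha> t(1) by (auto simp: \<beta>_def PiE_iff extensional_def)
  define a' b' where "a' = a + b * t * p ^ ?i * (\<Delta> * \<Delta>)" and "b' = b + a * t * p ^ ?i"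
  have "(\<Prod>i\<in>{m..<m + l}. u_gen p \<Delta> i (\<beta> i)) = a + b * \<Delta>"
    unfolding ab(1)[symmetric] by (rule prod.cong) (auto simp: \<beta>_def)
  then have prod: "(\<Prod>i\<in>{m..<m + Suc l}. u_gen p \<Delta> i (\<beta> i)) = a' + b' * \<Delta>"
    by (simp add: u_gen_mult a'_def b'_def) (simp add: \<beta>_def)
  have tp: "t * p ^ ?i \<in> \<pp> (int ?i)"
    using t(3) by (intro frac_ideal_mult[of _ 0 _ "int ?i"]) (auto simp: p_power_mem_iff)
  \<comment> \<open>Since \<open>p\<close> divides \<open>b\<close>, the change in \<open>a\<close>
    caused by the new factor is negligible at this precision.\<close>
  have btp: "b * (t * p ^ ?i) * (\<Delta> * \<Delta>) \<in> \<pp> (int ?i + 1)"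
    using m by (intro frac_ideal_mult[OF frac_ideal_mult[OF ab(3) tp order_refl] Delta_square_mem]) simp
  have "b * (t * p ^ ?i) * (\<Delta> * \<Delta>) \<in> \<pp> 1" using btp by (rule frac_ideal_mono) simp
  from frac_ideal_add[OF ab(2) this] have "a' - 1 \<in> \<pp> 1"
    by (simp add: a'_def algebra_simps)
  moreover have "b' \<in> \<pp> (int m)"
    using frac_ideal_add[OF ab(3) frac_ideal_mult[OF a(4) tp, of "int m"]]
    by (simp add: b'_def mult.assoc)
  moreover have "b' - c * a' \<in> \<pp> (int (m + Suc l))"
  proof -
    have "b - c * a = - (a * p ^ ?i * x0)" using a by (simp add: x0_def)
    then have "b' - c * a' = - (a * p ^ ?i * (x0 - t)) - c * (b * (t * p ^ ?i) * (\<Delta> * \<Delta>))"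
      by (simp add: a'_def b'_def algebra_simps)
    moreover have "a * p ^ ?i \<in> \<pp> (int ?i)"
      using a(4) by (intro frac_ideal_mult[of _ 0 _ "int ?i"]) (auto simp: p_power_mem_iff)
    then have "- (a * p ^ ?i * (x0 - t)) \<in> \<pp> (int ?i + 1)"
      using frac_ideal_mult[OF _ xt] by (intro frac_ideal_uminus) simp
    moreover have "c * (b * (t * p ^ ?i) * (\<Delta> * \<Delta>)) \<in> \<pp> (int ?i + 1)"
      using frac_ideal_mult[OF c btp, of "int ?i + 1"] by simp
    ultimately have "b' - c * a' \<in> \<pp> (int ?i + 1)" by (metis frac_ideal_diff)
    then show ?thesis by (simp add: algebra_simps)
  qed
  ultimately show ?case using \<beta> prod by blast
qed

text \<open>The translate by \<open>a + b * \<Delta>\<close> depends only on the slope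
  \<open>b / a\<close> modulo \<open>p ^ n\<close>. The slopes of the \<open>u_tuple\<close>
  elements lie in \<open>\<pp> (int (n - d))\<close>, and successive approximation over
  \<open>d\<close> digits reaches every class there.\<close>

lemma unit_translates_eq:
  assumes R: "residue_reps K v p R" and d: "d < n"
  shows "{homothety_class K ((*) (u_tuple p \<Delta> d n \<alpha>) ` quad_order K v p \<Delta> n) | \<alpha>.
            \<alpha> \<in> index_tuples R d n} = {vertex c (int n) | c. c \<in> \<pp> (int (n - d))}" (is "?A = ?B")
proof -
  let ?m = "n - d"
  have m: "1 \<le> ?m" "?m + d = n" using d by auto
  have class_eq: "homothety_class K ((*) (a + b * \<Delta>) ` quad_order K v p \<Delta> n) = vertex (b / a) (int n)"
    and slope: "b / a \<in> \<pp> (int ?m)"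
    if "a - 1 \<in> \<pp> 1" "b \<in> \<pp> (int ?m)" for a b
  proof -
    note a = unit_of_mem_one_plus[OF that(1)]
    have "b \<in> \<pp> 1" using that(2) by (rule frac_ideal_mono) (use m in simp)
    then show "homothety_class K ((*) (a + b * \<Delta>) ` quad_order K v p \<Delta> n) = vertex (b / a) (int n)"
      using that a frac_ideal_K[of b]
      by (simp add: quad_order_eq unit_scale_lat homothety_class_lat)
    show "b / a \<in> \<pp> (int ?m)" using that a by (intro frac_ideal_divide) auto
  qed
  show ?thesis
  proof (intro equalityI subsetI)
    fix x assume "x \<in> ?A"
    then obtain \<alpha> where \<alpha>: "\<alpha> \<in> {?m..<n} \<rightarrow>\<^sub>E R"
      "x = homothety_class K ((*) (u_tuple p \<Delta> d n \<alpha>) ` quad_order K v p \<Delta> n)"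
      by (auto simp: index_tuples_def)
    have "\<alpha> i \<in> \<pp> 0" if "i \<in> {?m..<?m + d}" for i
      using PiE_mem[OF \<alpha>(1), of i] that R m unfolding residue_reps_def val_ring_eq by auto
    then obtain a b where ab: "u_tuple p \<Delta> d n \<alpha> = a + b * \<Delta>" "a - 1 \<in> \<pp> 1" "b \<in> \<pp> (int ?m)"
      using prod_u_gen_coords[of ?m d \<alpha>] m unfolding u_tuple_def by auto
    then show "x \<in> ?B" using \<alpha>(2) class_eq slope by auto
  next
    fix x assume "x \<in> ?B"
    then obtain c where c: "x = vertex c (int n)" "c \<in> \<pp> (int ?m)" by blast
    obtain \<alpha> a b where \<alpha>: "\<alpha> \<in> {?m..<n} \<rightarrow>\<^sub>E R"
      and ab: "u_tuple p \<Delta> d n \<alpha> = a + b * \<Delta>" "a - 1 \<in> \<pp> 1" "b \<in> \<pp> (int ?m)"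
        "b - c * a \<in> \<pp> (int n)"
      using prod_u_gen_slope_surj[OF R m(1) c(2), of d] unfolding u_tuple_def m(2) by blast
    note a = unit_of_mem_one_plus[OF ab(2)]
    have "(b - c * a) / a \<in> \<pp> (int n)" using ab(4) a by (intro frac_ideal_divide) auto
    then have "b / a - c \<in> \<pp> (int n)" using a by (simp add: diff_divide_distrib)
    then have "vertex (b / a) (int n) = x"
      unfolding c(1) using slope[OF ab(2,3)] c(2) frac_ideal_K by (intro vertex_cong) auto
    then have "x = homothety_class K ((*) (u_tuple p \<Delta> d n \<alpha>) ` quad_order K v p \<Delta> n)"
      using class_eq ab by simp
    then show "x \<in> ?A" using \<alpha> by (auto simp: index_tuples_def)
  qed
qed

end

theorem theorem5p25:
  fixes K :: "'a::field_char_0 set" and v :: "'a \<Rightarrow> int"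
    and p \<epsilon> \<Delta> :: 'a and R :: "'a set" and n d :: nat
  assumes "nonarch_local_field K v"
    and "uniformizer K v p"
    and "val_unit K v \<epsilon>" and "\<not> (\<exists>y\<in>K. y ^ 2 = \<epsilon>)"
    and "\<Delta> ^ 2 = \<epsilon>" and "field_adjoin K \<Delta> = UNIV"
    and "unramified K v p"
    and "residue_reps K v p R"
    and "2 \<le> n" and "1 \<le> d" and "d < n"
  shows "{homothety_class K ((*) (u_tuple p \<Delta> d n \<alpha>) ` quad_order K v p \<Delta> n) | \<alpha>.
            \<alpha> \<in> index_tuples R d n} =
         {x \<in> verts (bt_tree K v p).
            graph_dist (bt_tree K v p) x (homothety_class K (quad_order K v p \<Delta> (n - d)))
              = ereal (real d) \<and>
            (\<forall>es. is_geodesic (bt_tree K v p) x es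
                     (homothety_class K (quad_order K v p \<Delta> (n - d))) \<longrightarrow>
               homothety_class K (quad_order K v p \<Delta> (n - d - 1))
                 \<notin> set (pre_digraph.awalk_verts (bt_tree K v p) x es))}"
proof -
  interpret nonarch_local_field K v by fact
  \<comment> \<open>\<open>\<Delta>\<close> is outside \<open>K\<close> because
    \<open>\<epsilon>\<close> has no square root there, and its square is integral because
    \<open>\<epsilon>\<close> is a unit.\<close>
  interpret quadratic_lattices K v p \<Delta>
    using assms by unfold_locales (auto simp: val_unit_def)
  have "homothety_class K (quad_order K v p \<Delta> i) = vertex 0 (int i)" for i
    by (simp add: quad_order_eq homothety_class_lat)
  \<comment> \<open>As \<open>d < n\<close>, truncated subtraction agrees with the integer levels
    \<open>m - 1\<close> and \<open>m + d\<close> for \<open>m = n - d\<close>.\<close>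
  moreover have "int (n - d - 1) = int (n - d) - 1" "int (n - d) + int d = int n"
    using assms by auto
  ultimately show ?thesis
    unfolding unit_translates_eq[OF \<open>residue_reps K v p R\<close> \<open>d < n\<close>]
    using sphere_away_from_predecessor[of "int (n - d)" d] by (simp only:)
qed

end
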